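(* Let $\Gamma$ be a discrete group, let $\mathbb{T}=\{z\in\mathbb{C}:|z|=1\}$, and let $\omega\colon\Gamma^3\to\mathbb{T}$ be a normalized $3$-cocycle. Regard $\Gamma$ as a $\Gamma$-set by the adjoint action. Then the normalized equivariant $2$-cochain $\Psi\in\bar{\mathrm{C}}^2_\Gamma(\Gamma;\mathbb{T})$ defined by $$\Psi[s,t](\gamma)=\omega(\gamma,s,t)\,\overline{\omega(s,s^{-1}\gamma s,t)}\,\omega(s,t,t^{-1}s^{-1}\gamma st)\qquad(s,t,\gamma\in\Gamma)$$ is a cocycle.
   Context: A normalized $3$-cocycle is a map $\omega\colon\Gamma^3\to\mathbb{T}$ with $\omega(\gamma_1,\gamma_2,\gamma_3)\omega(\gamma_1,\gamma_2\gamma_3,\gamma_4)\omega(\gamma_2,\gamma_3,\gamma_4)=\omega(\gamma_1\gamma_2,\gamma_3,\gamma_4)\omega(\gamma_1,\gamma_2,\gamma_3\gamma_4)$ for all $\gamma_i\in\Gamma$, and $\omega(\gamma_1,\gamma_2,\gamma_3)=1$ whenever some $\gamma_i=e$. For a $\Gamma$-set $X$, the space $\bar{\mathrm{C}}^n_\Gamma(X;\mathbb{T})$ of normalized equivariant cochains is the space of normalized group cochains $\Gamma^n\to\mathrm{Map}(X,\mathbb{T})$ (equal to the constant function $1$ whenever one of the arguments is $e$), where $\Gamma$ acts on $\mathrm{Map}(X,\mathbb{T})$ by $(\gamma f)(x)=f(\gamma^{-1}x)$, with the usual group cohomology coboundary. For the adjoint action of $\Gamma$ on $X=\Gamma$,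 a cochain $\Xi\in\bar{\mathrm{C}}^2_\Gamma(\Gamma;\mathbb{T})$ is a cocycle if and only if $$\Xi[t,u](s^{-1}\gamma s)\,\overline{\Xi[st,u](\gamma)}\,\Xi[s,tu](\gamma)\,\overline{\Xi[s,t](\gamma)}=1\quad\text{for all }s,t,u,\gamma\in\Gamma.$$ *)

theory Defs
  imports Complex_Main "HOL-Library.FuncSet" "HOL-Algebra.Group_Action"
begin

abbreviation unit_circle :: "complex set"  (\<open>\<T>\<close>)
  where "\<T> \<equiv> {z. cmod z = 1}"

definition normalized_3_cocycle ::
  "('g, 'm) monoid_scheme \<Rightarrow> ('g \<Rightarrow> 'g \<Rightarrow> 'g \<Rightarrow> complex) \<Rightarrow> bool"
  where "normalized_3_cocycle G \<omega> \<longleftrightarrow>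
    (\<forall>a\<in>carrier G. \<forall>b\<in>carrier G. \<forall>c\<in>carrier G. \<omega> a b c \<in> \<T>) \<and>
    (\<forall>a\<in>carrier G. \<forall>b\<in>carrier G. \<forall>c\<in>carrier G. \<forall>d\<in>carrier G.
       \<omega> a b c * \<omega> a (b \<otimes>\<^bsub>G\<^esub> c) d * \<omega> b c d = \<omega> (a \<otimes>\<^bsub>G\<^esub> b) c d * \<omega> a b (c \<otimes>\<^bsub>G\<^esub> d)) \<and>
    (\<forall>a\<in>carrier G. \<forall>b\<in>carrier G. \<forall>c\<in>carrier G.
       a = \<one>\<^bsub>G\<^esub> \<or> b = \<one>\<^bsub>G\<^esub> \<or> c = \<one>\<^bsub>G\<^esub> \<longrightarrow> \<omega> a b c = 1)"

text \<open>
  An \<open>n\<close>-cochain is a function on lists of length \<open>n\<close>, with values in the group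
  \<open>Map(X, \<T>)\<close> under pointwise multiplication.  Its values on lists of other lengths, on lists
  with entries outside the group, and at points outside \<open>X\<close> are irrelevant and unconstrained.
\<close>

definition normalized_cochains ::
  "('g, 'm) monoid_scheme \<Rightarrow> 'x set \<Rightarrow> nat \<Rightarrow> ('g list \<Rightarrow> 'x \<Rightarrow> complex) set"
  where "normalized_cochains G X n =
    {\<Xi>. \<forall>gs. length gs = n \<and> set gs \<subseteq> carrier G \<longrightarrow>
           \<Xi> gs \<in> X \<rightarrow> \<T> \<and> (\<one>\<^bsub>G\<^esub> \<in> set gs \<longrightarrow> (\<forall>x\<in>X. \<Xi> gs x = 1))}"

definition act_Map ::
  "('g, 'm) monoid_scheme \<Rightarrow> ('g \<Rightarrow> 'x \<Rightarrow> 'x) \<Rightarrow> 'g \<Rightarrow> ('x \<Rightarrow> complex) \<Rightarrow> 'x \<Rightarrow> complex"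
  where "act_Map G \<phi> g f = (\<lambda>x. f (\<phi> (inv\<^bsub>G\<^esub> g) x))"

definition contract_at :: "('g, 'm) monoid_scheme \<Rightarrow> nat \<Rightarrow> 'g list \<Rightarrow> 'g list"
  where "contract_at G i gs = take i gs @ (gs ! i \<otimes>\<^bsub>G\<^esub> gs ! Suc i) # drop (i + 2) gs"

text \<open>
  The inhomogeneous coboundary, written multiplicatively; \<open>gs\<close> has length \<open>n + 1\<close>.  Positions in
  \<open>gs\<close> are counted from \<open>0\<close>, so contracting positions \<open>i\<close> and \<open>i + 1\<close> has sign \<open>(-1) ^ (i + 1)\<close>.
\<close>

definition coboundary ::
  "('g, 'm) monoid_scheme \<Rightarrow> ('g \<Rightarrow> 'x \<Rightarrow> 'x) \<Rightarrow> nat \<Rightarrow> ('g list \<Rightarrow> 'x \<Rightarrow> complex) \<Rightarrow>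
    'g list \<Rightarrow> 'x \<Rightarrow> complex"
  where "coboundary G \<phi> n \<Xi> gs x =
    act_Map G \<phi> (hd gs) (\<Xi> (tl gs)) x *
    (\<Prod>i<n. \<Xi> (contract_at G i gs) x powi ((-1) ^ (i + 1))) *
    \<Xi> (butlast gs) x powi ((-1) ^ (n + 1))"

definition normalized_cocycles ::
  "('g, 'm) monoid_scheme \<Rightarrow> 'x set \<Rightarrow> ('g \<Rightarrow> 'x \<Rightarrow> 'x) \<Rightarrow> nat \<Rightarrow> ('g list \<Rightarrow> 'x \<Rightarrow> complex) set"
  where "normalized_cocycles G X \<phi> n =
    {\<Xi> \<in> normalized_cochains G X n.
       \<forall>gs. length gs = n + 1 \<and> set gs \<subseteq> carrier G \<longrightarrow> (\<forall>x\<in>X. coboundary G \<phi> n \<Xi> gs x = 1)}"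

text \<open>This is the action of \<open>group.action_by_conjugation\<close>.\<close>

definition adjoint_action :: "('g, 'm) monoid_scheme \<Rightarrow> 'g \<Rightarrow> 'g \<Rightarrow> 'g"
  where "adjoint_action G = (\<lambda>g. \<lambda>h\<in>carrier G. g \<otimes>\<^bsub>G\<^esub> h \<otimes>\<^bsub>G\<^esub> inv\<^bsub>G\<^esub> g)"

lemma (in group) group_action_adjoint: "group_action G (carrier G) (adjoint_action G)"
  unfolding adjoint_action_def by (rule action_by_conjugation)

lemma unit_circle_inverse: "z \<in> \<T> \<Longrightarrow> inverse z = cnj z"
  using complex_norm_square[of z] by (auto intro: inverse_unique)

lemma (in group) adjoint_2_cocycle_iff:
  assumes "\<Xi> \<in> normalized_cochains G (carrier G) 2"
  shows "\<Xi> \<in> normalized_cocycles G (carrier G) (adjoint_action G) 2 \<longleftrightarrow>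
    (\<forall>s\<in>carrier G. \<forall>t\<in>carrier G. \<forall>u\<in>carrier G. \<forall>\<gamma>\<in>carrier G.
       \<Xi> [t, u] (inv s \<otimes> \<gamma> \<otimes> s) * cnj (\<Xi> [s \<otimes> t, u] \<gamma>) *
       \<Xi> [s, t \<otimes> u] \<gamma> * cnj (\<Xi> [s, t] \<gamma>) = 1)"
proof -
  have T: "inverse (\<Xi> [a, b] x) = cnj (\<Xi> [a, b] x)"
    if "a \<in> carrier G" "b \<in> carrier G" "x \<in> carrier G" for a b x
    using assms that by (intro unit_circle_inverse) (auto simp: normalized_cochains_def Pi_iff)
  have eq: "coboundary G (adjoint_action G) 2 \<Xi> [s, t, u] \<gamma> =
       \<Xi> [t, u] (inv s \<otimes> \<gamma> \<otimes> s) * cnj (\<Xi> [s \<otimes> t, u] \<gamma>) *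
       \<Xi> [s, t \<otimes> u] \<gamma> * cnj (\<Xi> [s, t] \<gamma>)"
    if "s \<in> carrier G" "t \<in> carrier G" "u \<in> carrier G" "\<gamma> \<in> carrier G" for s t u \<gamma>
    using that
    by (simp add: coboundary_def act_Map_def adjoint_action_def contract_at_def
        lessThan_Suc numeral_2_eq_2 power_int_minus flip: T)
  have len: "(\<forall>gs. length gs = 3 \<and> set gs \<subseteq> carrier G \<longrightarrow> P gs) \<longleftrightarrow>
      (\<forall>s\<in>carrier G. \<forall>t\<in>carrier G. \<forall>u\<in>carrier G. P [s, t, u])" for P
    by (auto simp: numeral_3_eq_3 length_Suc_conv)
  show ?thesis
    using assms by (simp add: normalized_cocycles_def len eq)
qed

end

theory Submission
  imports Defs
begin

text \<open>
  Write \<open>\<partial>\<omega>(a, b, c, d)\<close> for the quotient of the two sides of the 3-cocycle identity, so that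
  \<open>\<partial>\<omega> = 1\<close>.  The three factors of \<open>\<Psi>[s, t](\<gamma>)\<close> are obtained by shuffling \<open>\<gamma>\<close> through the pair
  \<open>(s, t)\<close>, with one sign change per step; each time \<open>\<gamma>\<close> jumps over a group element it is
  conjugated by it, so that the total product is unchanged.  Shuffling \<open>\<gamma>\<close> through a triple
  \<open>(s, t, u)\<close> in the same way visits \<open>a = \<gamma>\<close>, then \<open>b\<close>, \<open>c\<close>, \<open>d\<close> with \<open>as = sb\<close>, \<open>bt = tc\<close>,
  \<open>cu = ud\<close>, and gives four instances of \<open>\<partial>\<omega> = 1\<close>, whose alternating product is
  \<open>\<partial>\<omega>(s, b, t, u) \<partial>\<omega>(s, t, u, d) = \<partial>\<omega>(a, s, t, u) \<partial>\<omega>(s, t, c, u)\<close>.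
  The terms containing one of the products \<open>as = sb\<close>, \<open>bt = tc\<close>, \<open>cu = ud\<close> occur twice with
  opposite signs, and so does \<open>\<omega>(s, t, u)\<close>, which comes from the first and the last position of
  \<open>\<gamma>\<close>.  What survives is exactly the 2-cocycle identity for \<open>\<Psi>\<close>; this is lemma
  \<open>shuffle_cocycle_identity\<close>.
\<close>

text \<open>
  Clearing denominators in the 2-cocycle identity makes conjugation disappear: only the
  intertwining relations between \<open>a\<close>, \<open>b\<close>, \<open>c\<close>, \<open>d\<close> matter, and they are what makes the unwanted
  terms of the four instances of the 3-cocycle identity cancel.
\<close>

lemma (in group) shuffle_cocycle_identity:
  fixes \<omega> :: "'a \<Rightarrow> 'a \<Rightarrow> 'a \<Rightarrow> 'k::field"
  assumes nonzero: "\<And>x y z. \<lbrakk>x \<in> carrier G; y \<in> carrier G; z \<in> carrier G\<rbrakk> \<Longrightarrow> \<omega> x y z \<noteq> 0"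
    and cocycle: "\<And>w x y z.
      \<lbrakk>w \<in> carrier G; x \<in> carrier G; y \<in> carrier G; z \<in> carrier G\<rbrakk> \<Longrightarrow>
      \<omega> w x y * \<omega> w (x \<otimes> y) z * \<omega> x y z = \<omega> (w \<otimes> x) y z * \<omega> w x (y \<otimes> z)"
    and carr [simp]: "s \<in> carrier G" "t \<in> carrier G" "u \<in> carrier G"
      "a \<in> carrier G" "b \<in> carrier G" "c \<in> carrier G" "d \<in> carrier G"
    and comm: "a \<otimes> s = s \<otimes> b" "b \<otimes> t = t \<otimes> c" "c \<otimes> u = u \<otimes> d"
  shows "(\<omega> b t u * \<omega> t u d * \<omega> (s \<otimes> t) c u) * (\<omega> a s (t \<otimes> u) * \<omega> s (t \<otimes> u) d * \<omega> s b t) =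
    (\<omega> a (s \<otimes> t) u * \<omega> (s \<otimes> t) u d * \<omega> t c u) * (\<omega> a s t * \<omega> s t c * \<omega> s b (t \<otimes> u))"
    (is "?L = ?R")
proof -
  \<comment> \<open>the terms that cancel; each lies in two of the four instances below\<close>
  let ?K = "\<omega> s t u * \<omega> (s \<otimes> b) t u * \<omega> s (t \<otimes> c) u * \<omega> s t (u \<otimes> d)"
  have 1: "\<omega> (s \<otimes> b) t u * \<omega> a s (t \<otimes> u) = \<omega> a s t * \<omega> a (s \<otimes> t) u * \<omega> s t u"
    using cocycle[of a s t u] comm by simp
  have 2: "\<omega> s b t * \<omega> s (t \<otimes> c) u * \<omega> b t u = \<omega> (s \<otimes> b) t u * \<omega> s b (t \<otimes> u)"
    using cocycle[of s b t u] comm by simp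
  have 3: "\<omega> (s \<otimes> t) c u * \<omega> s t (u \<otimes> d) = \<omega> s t c * \<omega> s (t \<otimes> c) u * \<omega> t c u"
    using cocycle[of s t c u] comm by simp
  have 4: "\<omega> s t u * \<omega> s (t \<otimes> u) d * \<omega> t u d = \<omega> (s \<otimes> t) u d * \<omega> s t (u \<otimes> d)"
    using cocycle[of s t u d] by simp
  have "?K * ?L =
      (\<omega> (s \<otimes> b) t u * \<omega> a s (t \<otimes> u)) * (\<omega> s b t * \<omega> s (t \<otimes> c) u * \<omega> b t u) *
      ((\<omega> (s \<otimes> t) c u * \<omega> s t (u \<otimes> d)) * (\<omega> s t u * \<omega> s (t \<otimes> u) d * \<omega> t u d))"
    by (simp only: ac_simps)
  also have "\<dots> = ?K * ?R"
    unfolding 1 2 3 4 by (simp only: ac_simps)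
  finally show ?thesis
    by (simp add: nonzero)
qed

theorem proposition4p7:
  fixes \<Gamma> (structure)
    and \<omega> :: "'g \<Rightarrow> 'g \<Rightarrow> 'g \<Rightarrow> complex"
    and \<Psi> :: "'g list \<Rightarrow> 'g \<Rightarrow> complex"
  assumes "group \<Gamma>"
    and "normalized_3_cocycle \<Gamma> \<omega>"
    and "\<And>s t \<gamma>. \<lbrakk>s \<in> carrier \<Gamma>; t \<in> carrier \<Gamma>; \<gamma> \<in> carrier \<Gamma>\<rbrakk> \<Longrightarrow>
      \<Psi> [s, t] \<gamma> = \<omega> \<gamma> s t * cnj (\<omega> s (inv s \<otimes> \<gamma> \<otimes> s) t) *
        \<omega> s t (inv t \<otimes> inv s \<otimes> \<gamma> \<otimes> s \<otimes> t)"
  shows "\<Psi> \<in> normalized_cocycles \<Gamma> (carrier \<Gamma>) (adjoint_action \<Gamma>) 2"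
proof -
  interpret group \<Gamma> by fact
  note \<Psi> = assms(3)
  have norm: "cmod (\<omega> a b c) = 1"
    if "a \<in> carrier \<Gamma>" "b \<in> carrier \<Gamma>" "c \<in> carrier \<Gamma>" for a b c
    using assms(2) that by (auto simp: normalized_3_cocycle_def)
  have nonzero: "\<omega> a b c \<noteq> 0"
    if "a \<in> carrier \<Gamma>" "b \<in> carrier \<Gamma>" "c \<in> carrier \<Gamma>" for a b c
    using norm[OF that] by auto
  have cnj: "cnj (\<omega> a b c) = inverse (\<omega> a b c)"
    if "a \<in> carrier \<Gamma>" "b \<in> carrier \<Gamma>" "c \<in> carrier \<Gamma>" for a b c
    using norm[OF that] by (simp add: unit_circle_inverse)
  have cocycle: "\<omega> a b c * \<omega> a (b \<otimes> c) d * \<omega> b c d = \<omega> (a \<otimes> b) c d * \<omega> a b (c \<otimes> d)"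
    if "a \<in> carrier \<Gamma>" "b \<in> carrier \<Gamma>" "c \<in> carrier \<Gamma>" "d \<in> carrier \<Gamma>" for a b c d
    using assms(2) that by (simp add: normalized_3_cocycle_def)
  have unit: "\<omega> a b c = 1"
    if "a = \<one> \<or> b = \<one> \<or> c = \<one>" "a \<in> carrier \<Gamma>" "b \<in> carrier \<Gamma>" "c \<in> carrier \<Gamma>" for a b c
    using assms(2) that unfolding normalized_3_cocycle_def by blast

  have \<Psi>_norm: "cmod (\<Psi> [s, t] \<gamma>) = 1"
    if "s \<in> carrier \<Gamma>" "t \<in> carrier \<Gamma>" "\<gamma> \<in> carrier \<Gamma>" for s t \<gamma>
    using that by (simp add: \<Psi> norm norm_mult)
  have \<Psi>_unit: "\<Psi> [s, t] \<gamma> = 1"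
    if "s = \<one> \<or> t = \<one>" "s \<in> carrier \<Gamma>" "t \<in> carrier \<Gamma>" "\<gamma> \<in> carrier \<Gamma>" for s t \<gamma>
    using that by (auto simp: \<Psi> unit)
  have cochain: "\<Psi> \<in> normalized_cochains \<Gamma> (carrier \<Gamma>) 2"
    by (auto simp: normalized_cochains_def numeral_2_eq_2 length_Suc_conv \<Psi>_norm \<Psi>_unit)

  have "\<Psi> [t, u] (inv s \<otimes> \<gamma> \<otimes> s) * cnj (\<Psi> [s \<otimes> t, u] \<gamma>) *
      \<Psi> [s, t \<otimes> u] \<gamma> * cnj (\<Psi> [s, t] \<gamma>) = 1"
    if [simp]: "s \<in> carrier \<Gamma>" "t \<in> carrier \<Gamma>" "u \<in> carrier \<Gamma>" "\<gamma> \<in> carrier \<Gamma>" for s t u \<gamma>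
  proof -
    define b where "b = inv s \<otimes> \<gamma> \<otimes> s"
    define c where "c = inv t \<otimes> b \<otimes> t"
    define d where "d = inv u \<otimes> c \<otimes> u"
    have carr [simp]: "b \<in> carrier \<Gamma>" "c \<in> carrier \<Gamma>" "d \<in> carrier \<Gamma>"
      by (simp_all add: b_def c_def d_def)
    have comm: "\<gamma> \<otimes> s = s \<otimes> b" "b \<otimes> t = t \<otimes> c" "c \<otimes> u = u \<otimes> d"
      by (simp_all add: b_def c_def d_def m_assoc[symmetric])
    have \<Psi>_st: "\<Psi> [s, t] \<gamma> = \<omega> \<gamma> s t * inverse (\<omega> s b t) * \<omega> s t c"
      by (simp add: \<Psi> cnj b_def c_def m_assoc)
    have \<Psi>_tu: "\<Psi> [t, u] b = \<omega> b t u * inverse (\<omega> t c u) * \<omega> t u d"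
      by (simp add: \<Psi> cnj c_def d_def m_assoc)
    have \<Psi>_st_u: "\<Psi> [s \<otimes> t, u] \<gamma> =
        \<omega> \<gamma> (s \<otimes> t) u * inverse (\<omega> (s \<otimes> t) c u) * \<omega> (s \<otimes> t) u d"
      by (simp add: \<Psi> cnj b_def c_def d_def m_assoc inv_mult_group)
    have \<Psi>_s_tu: "\<Psi> [s, t \<otimes> u] \<gamma> =
        \<omega> \<gamma> s (t \<otimes> u) * inverse (\<omega> s b (t \<otimes> u)) * \<omega> s (t \<otimes> u) d"
      by (simp add: \<Psi> cnj b_def c_def d_def m_assoc inv_mult_group)
    have cleared: "\<Psi> [t, u] b * \<Psi> [s, t \<otimes> u] \<gamma> = \<Psi> [s \<otimes> t, u] \<gamma> * \<Psi> [s, t] \<gamma>"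
      unfolding \<Psi>_st \<Psi>_tu \<Psi>_st_u \<Psi>_s_tu
      using shuffle_cocycle_identity[OF nonzero cocycle, where s = s and t = t and u = u
          and a = \<gamma> and b = b and c = c and d = d] comm
      by (simp add: nonzero field_simps)
    have cnj_\<Psi>: "cnj (\<Psi> [s \<otimes> t, u] \<gamma>) = inverse (\<Psi> [s \<otimes> t, u] \<gamma>)"
        "cnj (\<Psi> [s, t] \<gamma>) = inverse (\<Psi> [s, t] \<gamma>)"
      by (simp_all add: unit_circle_inverse \<Psi>_norm)
    have "\<Psi> [s \<otimes> t, u] \<gamma> \<noteq> 0" "\<Psi> [s, t] \<gamma> \<noteq> 0"
      using \<Psi>_norm[of "s \<otimes> t" u \<gamma>] \<Psi>_norm[of s t \<gamma>] by auto
    then show ?thesis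
      using cleared unfolding b_def[symmetric] cnj_\<Psi> by (simp add: divide_simps mult_ac)
  qed
  then show ?thesis
    using adjoint_2_cocycle_iff[OF cochain] by blast
qed

end
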